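(* Let $I,J,K$ be positive integers, let $t_i\in[I]$, $s_{ij}\in[J]$ $(i\in[I], j\in[J])$, and for each $(i,j)$ let $k\mapsto r_{ijk}$ be a permutation of $[K]$. Let $z^*$ be the optimal value of the first-stage problem $$\max_{\mathbf w\in\mathcal W,\ z\in\mathbb R} z\quad\text{s.t. } z\le \delta_{ijk}(\mathbf w)\ \ \forall (i,j,k)\in[I]\times[J]\times[K],$$ and let $\mathbf w$ be any optimal solution of the second-stage problem $$\max_{\mathbf w\in\mathcal W}\ \sum_{i=1}^I\sum_{j=1}^J\sum_{k=1}^K\delta_{ijk}(\mathbf w)\quad\text{s.t. } z^*\le\delta_{ijk}(\mathbf w)\ \ \forall (i,j,k)\in[I]\times[J]\times[K].$$ Then $\mathbf w$ is efficient.
   Context: $[n]=\{1,\dots,n\}$. Indices: $i\in[I]$ experts, $j\in[J]$ attributes, $k\in[K]$ alternatives; $t_i,s_{ij},r_{ijk}$ are positive-integer rankings (1 = best). $\mathcal W=\{\mathbf w=(w_{ijk})\in\mathbb R^{I\times J\times K}: \sum_{i,j,k}w_{ijk}=1,\ w_{ijk}\ge0\}$. The objective vector $\delta(\mathbf w)=(\delta_{ijk}(\mathbf w))$ is defined by: if $r_{ijk}\le K-1$ and $l$ is the alternative with $r_{ijl}=r_{ijk}+1$, then $\delta_{ijk}(\mathbf w)=t_is_{ij}r_{ijk}(w_{ijk}-w_{ijl})$; if $r_{ijk}=K$, then $\delta_{ijk}(\mathbf w)=t_is_{ij}r_{ijk}w_{ijk}$. A point $\mathbf w\in\mathcal W$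 dominates $\mathbf w'\in\mathcal W$ if there is an index $(i,j,k)'$ with $\delta_{(i,j,k)'}(\mathbf w)>\delta_{(i,j,k)'}(\mathbf w')$ and $\delta_{ijk}(\mathbf w)\ge\delta_{ijk}(\mathbf w')$ for all other indices $(i,j,k)$. A feasible point $\mathbf w\in\mathcal W$ is efficient if no $\mathbf w'\in\mathcal W$ dominates it. *)

theory Defs
  imports "HOL-Analysis.Analysis"
begin

type_synonym index = "nat \<times> nat \<times> nat"

definition indices :: "nat \<Rightarrow> nat \<Rightarrow> nat \<Rightarrow> index set" where
  "indices I J K = {1..I} \<times> {1..J} \<times> {1..K}"

text \<open>A vector in \<open>\<real>\<^bsup>I \<times> J \<times> K\<^esup>\<close> is an extensional function on \<open>indices I J K\<close>, so that
  distinct functions represent distinct vectors.\<close>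

definition weights :: "nat \<Rightarrow> nat \<Rightarrow> nat \<Rightarrow> (index \<Rightarrow> real) set" where
  "weights I J K =
     {w \<in> indices I J K \<rightarrow>\<^sub>E UNIV. (\<Sum>p\<in>indices I J K. w p) = 1 \<and> (\<forall>p\<in>indices I J K. w p \<ge> 0)}"

definition next_alternative :: "nat \<Rightarrow> (nat \<Rightarrow> nat) \<Rightarrow> nat \<Rightarrow> nat" where
  "next_alternative K \<rho> k = (THE l. l \<in> {1..K} \<and> \<rho> l = \<rho> k + 1)"

text \<open>The second branch is the case of rank \<open>K\<close>, as ranks lie in \<open>{1..K}\<close>.\<close>

definition objective ::
  "nat \<Rightarrow> (nat \<Rightarrow> nat) \<Rightarrow> (nat \<Rightarrow> nat \<Rightarrow> nat) \<Rightarrow> (nat \<Rightarrow> nat \<Rightarrow> nat \<Rightarrow> nat)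
     \<Rightarrow> (index \<Rightarrow> real) \<Rightarrow> index \<Rightarrow> real" where
  "objective K t s r w = (\<lambda>(i, j, k).
     if r i j k \<le> K - 1
     then real (t i) * real (s i j) * real (r i j k)
            * (w (i, j, k) - w (i, j, next_alternative K (r i j) k))
     else real (t i) * real (s i j) * real (r i j k) * w (i, j, k))"

definition dominates ::
  "index set \<Rightarrow> ((index \<Rightarrow> real) \<Rightarrow> index \<Rightarrow> real) \<Rightarrow> (index \<Rightarrow> real) \<Rightarrow> (index \<Rightarrow> real) \<Rightarrow> bool" where
  "dominates P \<delta> w w' \<longleftrightarrow> (\<exists>p\<in>P. \<delta> w p > \<delta> w' p \<and> (\<forall>q\<in>P - {p}. \<delta> w q \<ge> \<delta> w' q))"

definition efficient ::
  "nat \<Rightarrow> nat \<Rightarrow> nat \<Rightarrow> (nat \<Rightarrow> nat) \<Rightarrow> (nat \<Rightarrow> nat \<Rightarrow> nat) \<Rightarrow> (nat \<Rightarrow> nat \<Rightarrow> nat \<Rightarrow> nat)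
     \<Rightarrow> (index \<Rightarrow> real) \<Rightarrow> bool" where
  "efficient I J K t s r w \<longleftrightarrow>
     w \<in> weights I J K \<and>
     \<not> (\<exists>w'\<in>weights I J K. dominates (indices I J K) (objective K t s r) w' w)"

definition first_stage_feasible ::
  "nat \<Rightarrow> nat \<Rightarrow> nat \<Rightarrow> (nat \<Rightarrow> nat) \<Rightarrow> (nat \<Rightarrow> nat \<Rightarrow> nat) \<Rightarrow> (nat \<Rightarrow> nat \<Rightarrow> nat \<Rightarrow> nat)
     \<Rightarrow> ((index \<Rightarrow> real) \<times> real) set" where
  "first_stage_feasible I J K t s r =
     {(w, z). w \<in> weights I J K \<and> (\<forall>p\<in>indices I J K. z \<le> objective K t s r w p)}"

text \<open>For positive \<open>I\<close>, \<open>J\<close>, \<open>K\<close> the supremum ranges over a nonempty set that is bounded above;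
  it is a maximum by compactness of the simplex.\<close>

definition first_stage_value ::
  "nat \<Rightarrow> nat \<Rightarrow> nat \<Rightarrow> (nat \<Rightarrow> nat) \<Rightarrow> (nat \<Rightarrow> nat \<Rightarrow> nat) \<Rightarrow> (nat \<Rightarrow> nat \<Rightarrow> nat \<Rightarrow> nat) \<Rightarrow> real" where
  "first_stage_value I J K t s r = (SUP (w, z)\<in>first_stage_feasible I J K t s r. z)"

definition second_stage_feasible ::
  "nat \<Rightarrow> nat \<Rightarrow> nat \<Rightarrow> (nat \<Rightarrow> nat) \<Rightarrow> (nat \<Rightarrow> nat \<Rightarrow> nat) \<Rightarrow> (nat \<Rightarrow> nat \<Rightarrow> nat \<Rightarrow> nat)
     \<Rightarrow> (index \<Rightarrow> real) set" where
  "second_stage_feasible I J K t s r =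
     {w \<in> weights I J K. \<forall>p\<in>indices I J K. first_stage_value I J K t s r \<le> objective K t s r w p}"

definition second_stage_optimal ::
  "nat \<Rightarrow> nat \<Rightarrow> nat \<Rightarrow> (nat \<Rightarrow> nat) \<Rightarrow> (nat \<Rightarrow> nat \<Rightarrow> nat) \<Rightarrow> (nat \<Rightarrow> nat \<Rightarrow> nat \<Rightarrow> nat)
     \<Rightarrow> (index \<Rightarrow> real) \<Rightarrow> bool" where
  "second_stage_optimal I J K t s r =
     is_arg_max (\<lambda>w. \<Sum>i=1..I. \<Sum>j=1..J. \<Sum>k=1..K. objective K t s r w (i, j, k))
       (\<lambda>w. w \<in> second_stage_feasible I J K t s r)"

end

theory Submission
  imports Defs
begin

text \<open>A point that dominates \<open>w\<close> is at least as good in every component of the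
  objective vector and better in one. It therefore keeps every lower bound \<open>w\<close>
  satisfies (\<open>dominates_le\<close>), in particular the first-stage one, so it is feasible for
  the second stage. Over the finite index set its component sum is strictly larger
  (\<open>dominates_sum_less\<close>), which contradicts the maximality of \<open>w\<close>.\<close>

lemma dominates_sum_less:
  assumes "finite P" and "dominates P \<delta> w' w"
  shows "sum (\<delta> w) P < sum (\<delta> w') P"
  using assms by (intro sum_strict_mono_ex1) (force simp: dominates_def)+

lemma dominates_le:
  assumes "dominates P \<delta> w' w" and "p \<in> P"
  shows "\<delta> w p \<le> \<delta> w' p"
  using assms by (force simp: dominates_def)

text \<open>Brings the triple sum of the second stage into the form in which domination compares
  sums.\<close>

lemma sum_indices:
  "(\<Sum>i=1..I. \<Sum>j=1..J. \<Sum>k=1..K. f (i, j, k)) = sum f (indices I J K)"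
  by (simp add: indices_def sum.cartesian_product case_prod_unfold)

theorem theorem1:
  fixes I J K :: nat
    and t :: "nat \<Rightarrow> nat"
    and s :: "nat \<Rightarrow> nat \<Rightarrow> nat"
    and r :: "nat \<Rightarrow> nat \<Rightarrow> nat \<Rightarrow> nat"
    and w :: "index \<Rightarrow> real"
  assumes "I \<ge> 1" and "J \<ge> 1" and "K \<ge> 1"
    and "\<And>i. i \<in> {1..I} \<Longrightarrow> t i \<in> {1..I}"
    and "\<And>i j. i \<in> {1..I} \<Longrightarrow> j \<in> {1..J} \<Longrightarrow> s i j \<in> {1..J}"
    and "\<And>i j. i \<in> {1..I} \<Longrightarrow> j \<in> {1..J} \<Longrightarrow> bij_betw (r i j) {1..K} {1..K}"
    and "second_stage_optimal I J K t s r w"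
  shows "efficient I J K t s r w"
proof -
  let ?\<delta> = "objective K t s r"
  have feasible: "w \<in> second_stage_feasible I J K t s r"
    and optimal: "\<And>v. v \<in> second_stage_feasible I J K t s r \<Longrightarrow>
      sum (?\<delta> v) (indices I J K) \<le> sum (?\<delta> w) (indices I J K)"
    \<comment> \<open>\<open>is_arg_max\<close> only says that no feasible point is strictly better;
      linearity of the order on the reals turns this into \<le>.\<close>
    using assms(7) unfolding second_stage_optimal_def is_arg_max_linorder sum_indices by blast+
  have "\<not> dominates (indices I J K) ?\<delta> v w" if "v \<in> weights I J K" for v
  proof
    assume dom: "dominates (indices I J K) ?\<delta> v w"
    \<comment> \<open>The first-stage value bounds each component at \<open>w\<close> from below,
      and passing to \<open>v\<close> lowers none of them.\<close>
    have "v \<in> second_stage_feasible I J K t s r"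
      using feasible that dominates_le[OF dom]
      by (auto simp: second_stage_feasible_def intro: order_trans)
    moreover have "sum (?\<delta> w) (indices I J K) < sum (?\<delta> v) (indices I J K)"
      using dom by (intro dominates_sum_less) (simp add: indices_def)
    ultimately show False
      using optimal by force
  qed
  with feasible show ?thesis
    by (auto simp: efficient_def second_stage_feasible_def)
qed

end
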